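(* Let $Q_n(8,4)$ and $Q'_n(8,4)$ be respectively the Möbius graph and the cylinder graph of the linear octagonal-quadrilateral network. Then $$\lim_{n\to\infty}\frac{W\big(Q_n(8,4)\big)}{Kf\big(Q_n(8,4)\big)}=3\qquad\text{and}\qquad \lim_{n\to\infty}\frac{W\big(Q'_n(8,4)\big)}{Kf\big(Q'_n(8,4)\big)}=3.$$
   Context: For each integer $n\ge1$, both graphs are simple undirected graphs on the $8n$ vertices $1,2,\dots,4n,1',2',\dots,(4n)'$ with $10n$ edges. They share the path edges $\{j,j+1\}$ and $\{j',(j+1)'\}$ for $1\le j\le 4n-1$ and the rungs $\{j,j'\}$ for all $1\le j\le 4n$ with $j\equiv 0$ or $1\pmod 4$. In addition, the Möbius graph $Q_n(8,4)$ has the two twisted closing edges $\{4n,1'\}$ and $\{(4n)',1\}$, while the cylinder graph $Q'_n(8,4)$ has the two untwisted closing edges $\{4n,1\}$ and $\{(4n)',1'\}$. For a connected graph $G$, the Wiener index is $W(G)=\sum_{i<j} d_{ij}$, where $d_{ij}$ is the length of a shortest path between vertices $i$ and $j$. The Kirchhoff index is $Kf(G)=\sum_{i<j} r_{ij}$, where $r_{ij}$ is the resistance distance (effective resistance) between $i$ and $j$ when each edge is regarded as a unit resistor. Both sums are over all unordered pairs of distinct vertices. *)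

theory Defs
  imports "HOL-Analysis.Analysis" "Graph_Theory.Graph_Theory"
begin

text \<open>
  A simple undirected graph is represented, as in the session \<open>Graph_Theory\<close>, by a
  \<open>pair_graph\<close>: a finite, loop-free digraph whose arc set is symmetric. Each undirected edge
  is thus present as two opposite arcs.
\<close>

subsection \<open>Wiener index and Kirchhoff index\<close>

text \<open>
  With unit arc weights, \<open>\<mu>\<close> is the number of edges of a shortest path. It is finite
  on connected graphs, so the conversion to a real number loses nothing there.
\<close>

definition graph_dist :: "'a pair_pre_digraph \<Rightarrow> 'a \<Rightarrow> 'a \<Rightarrow> real" where
  "graph_dist G u v = real_of_ereal (wf_digraph.\<mu> (with_proj G) (\<lambda>_. 1) u v)"

text \<open>
  \<open>\<phi>\<close> is the electric potential when every edge is a unit resistor and a unit current enters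
  at \<open>s\<close> and leaves at \<open>t\<close>: by Ohm's law the current from \<open>u\<close> to a neighbour \<open>w\<close> is
  \<open>\<phi> u - \<phi> w\<close>, and Kirchhoff's current law gives the net outflow at every vertex.
\<close>

definition unit_current_potential ::
    "'a pair_pre_digraph \<Rightarrow> 'a \<Rightarrow> 'a \<Rightarrow> ('a \<Rightarrow> real) \<Rightarrow> bool" where
  "unit_current_potential G s t \<phi> \<longleftrightarrow>
     (\<forall>u\<in>pverts G. (\<Sum>w | (u, w) \<in> parcs G. \<phi> u - \<phi> w) = of_bool (u = s) - of_bool (u = t))"

text \<open>
  The effective resistance is the potential drop from \<open>s\<close> to \<open>t\<close>. On a connected graph such a
  \<open>\<phi>\<close> exists and is unique up to an additive constant.
\<close>

definition resistance_dist :: "'a pair_pre_digraph \<Rightarrow> 'a \<Rightarrow> 'a \<Rightarrow> real" where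
  "resistance_dist G s t = (THE r. \<exists>\<phi>. unit_current_potential G s t \<phi> \<and> r = \<phi> s - \<phi> t)"

text \<open>
  Sum over unordered pairs of distinct vertices, for symmetric \<open>d\<close>: the sum over ordered
  pairs counts every unordered pair twice.
\<close>

definition pair_sum :: "'a pair_pre_digraph \<Rightarrow> ('a \<Rightarrow> 'a \<Rightarrow> real) \<Rightarrow> real" where
  "pair_sum G d = (\<Sum>(u, v) | u \<in> pverts G \<and> v \<in> pverts G \<and> u \<noteq> v. d u v) / 2"

definition wiener_index :: "'a pair_pre_digraph \<Rightarrow> real" where
  "wiener_index G = pair_sum G (graph_dist G)"

definition kirchhoff_index :: "'a pair_pre_digraph \<Rightarrow> real" where
  "kirchhoff_index G = pair_sum G (resistance_dist G)"

subsection \<open>The linear octagonal-quadrilateral networks\<close>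

text \<open>
  The vertex \<open>j\<close> is encoded as \<open>(j, False)\<close> and the vertex \<open>j'\<close> as \<open>(j, True)\<close>.
  The edge sets below list each undirected edge in one orientation;
  \<open>mk_symmetric\<close> adds the reverse arcs.
\<close>

definition octquad_verts :: "nat \<Rightarrow> (nat \<times> bool) set" where
  "octquad_verts n = {1..4 * n} \<times> UNIV"

definition octquad_edges :: "nat \<Rightarrow> ((nat \<times> bool) \<times> (nat \<times> bool)) set" where
  "octquad_edges n =
     {((j, b), (j + 1, b)) | j b. 1 \<le> j \<and> j \<le> 4 * n - 1} \<union>
     {((j, False), (j, True)) | j. 1 \<le> j \<and> j \<le> 4 * n \<and> (j mod 4 = 0 \<or> j mod 4 = 1)}"

definition octquad_moebius :: "nat \<Rightarrow> (nat \<times> bool) pair_pre_digraph" where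
  "octquad_moebius n = mk_symmetric (with_proj
     \<lparr>pverts = octquad_verts n,
      parcs = octquad_edges n \<union> {((4 * n, False), (1, True)), ((4 * n, True), (1, False))}\<rparr>)"

definition octquad_cylinder :: "nat \<Rightarrow> (nat \<times> bool) pair_pre_digraph" where
  "octquad_cylinder n = mk_symmetric (with_proj
     \<lparr>pverts = octquad_verts n,
      parcs = octquad_edges n \<union> {((4 * n, False), (1, False)), ((4 * n, True), (1, True))}\<rparr>)"

lemma finite_octquad_verts [simp]: "finite (octquad_verts n)"
  by (simp add: octquad_verts_def)

lemma octquad_edges_subset: "octquad_edges n \<subseteq> octquad_verts n \<times> octquad_verts n"
  by (auto simp: octquad_edges_def octquad_verts_def)

lemma pair_graph_mk_symmetric:
  assumes "finite V" "E \<subseteq> V \<times> V" "\<And>u. (u, u) \<notin> E"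
  shows "pair_graph (mk_symmetric (with_proj \<lparr>pverts = V, parcs = E\<rparr>))"
proof -
  have *: "parcs (mk_symmetric (with_proj \<lparr>pverts = V, parcs = E\<rparr>)) = E \<union> E\<inverse>"
    by (auto simp: parcs_mk_symmetric)
  have "finite E" using assms finite_subset by blast
  then show ?thesis
    using assms by unfold_locales (auto simp: * symmetric_def sym_Un_converse)
qed

lemma pair_graph_octquad:
  assumes "n \<ge> 1"
  shows "pair_graph (octquad_moebius n)" "pair_graph (octquad_cylinder n)"
  unfolding octquad_moebius_def octquad_cylinder_def
  using assms octquad_edges_subset[of n]
  by (intro pair_graph_mk_symmetric; auto simp: octquad_verts_def octquad_edges_def)+

end

theory Submission
  imports Defs
begin

text \<open>
  Let \<open>L = 4 n\<close> be the number of columns, where the column \<open>j\<close> consists of the vertices \<open>j\<close> and \<open>j'\<close>.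
  Up to a bounded error, both metrics depend only on the distance \<open>d\<close> of two columns along the
  cycle of columns:
  \<^item> the graph distance is \<open>min d (L - d)\<close>, with an error of at most \<open>3\<close>
    (\<open>octquad_ring_graph_dist_approx\<close>);
  \<^item> the resistance is \<open>d (L - d) / (2 L)\<close>, the resistance of a cycle in which the two parallel sides
    act as edges of resistance \<open>1 / 2\<close>, with an error of at most \<open>4\<close>
    (\<open>octquad_ring_resistance_approx\<close>).

  The mean over \<open>d\<close> is about \<open>L / 4\<close> in the first case and about \<open>L / 12\<close> in the second, whence the
  ratio \<open>3\<close>. With about \<open>2 L\<^sup>2\<close> pairs the indices are \<open>L\<^sup>3 / 2\<close> and \<open>L\<^sup>3 / 6\<close> up to errors of
  order \<open>L\<^sup>2\<close>, which disappear in the limit. Closing the network with or without a twist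
  affects only the error terms.

  For the distance one projects walks to the cycle of columns, and conversely follows a side round
  the network and changes sides once at the end. For the resistance, exchanging the two sides is a
  symmetry, so a potential splits into an even and an odd part. The even part does not see the rungs
  and is an explicit parabola. In the odd part each rung acts as a leak, which turns
  averaging over the neighbours into a contraction of a suitably weighted supremum norm;
  \<open>weighted_contraction_solution\<close> yields an odd part bounded independently of \<open>n\<close>. Since the Laplacian is self-adjoint, any potential determines
  the resistance (\<open>resistance_dist_eq\<close>), so that exhibiting one is enough.
\<close>

section \<open>Neighbourhoods in the closed networks\<close>

text \<open>
  The two networks differ only in whether the side changes when the seam between the columns
  \<open>4n\<close> and \<open>1\<close> is crossed. The flag \<open>\<tau>\<close> records this, so that both are treated at once.
\<close>

definition octquad_ring :: "bool \<Rightarrow> nat \<Rightarrow> (nat \<times> bool) pair_pre_digraph" where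
  "octquad_ring \<tau> n = mk_symmetric (with_proj
     \<lparr>pverts = octquad_verts n,
      parcs = octquad_edges n \<union> {((4 * n, False), (1, \<tau>)), ((4 * n, True), (1, \<not> \<tau>))}\<rparr>)"

lemma octquad_moebius_eq_ring: "octquad_moebius n = octquad_ring True n"
  and octquad_cylinder_eq_ring: "octquad_cylinder n = octquad_ring False n"
  by (simp_all add: octquad_moebius_def octquad_cylinder_def octquad_ring_def)

lemma pair_graph_octquad_ring: "n \<ge> 1 \<Longrightarrow> pair_graph (octquad_ring \<tau> n)"
  using pair_graph_octquad[of n] octquad_moebius_eq_ring[of n] octquad_cylinder_eq_ring[of n]
  by (cases \<tau>) auto

lemma pverts_octquad_ring [simp]: "pverts (octquad_ring \<tau> n) = octquad_verts n"
  by (simp add: octquad_ring_def)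

lemma octquad_verts_iff [simp]: "(i, b) \<in> octquad_verts n \<longleftrightarrow> 1 \<le> i \<and> i \<le> 4 * n"
  by (simp add: octquad_verts_def)

fun flip :: "nat \<times> bool \<Rightarrow> nat \<times> bool" where
  "flip (i, b) = (i, \<not> b)"

fun rung :: "nat \<times> bool \<Rightarrow> bool" where
  "rung (i, b) \<longleftrightarrow> i mod 4 = 0 \<or> i mod 4 = 1"

text \<open>
  The neighbours along the two sides, as total maps on all pairs. They commute with \<^const>\<open>flip\<close>,
  whichever way the network is closed; this symmetry splits potentials into an even and an odd part.
\<close>

fun nxt :: "bool \<Rightarrow> nat \<Rightarrow> nat \<times> bool \<Rightarrow> nat \<times> bool" where
  "nxt \<tau> n (i, b) = (if i = 4 * n then (1, b \<noteq> \<tau>) else (i + 1, b))"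

fun prv :: "bool \<Rightarrow> nat \<Rightarrow> nat \<times> bool \<Rightarrow> nat \<times> bool" where
  "prv \<tau> n (i, b) = (if i = 1 then (4 * n, b \<noteq> \<tau>) else (i - 1, b))"

lemma mk_symmetric_arc_iff:
  "(u, v) \<in> parcs (mk_symmetric (with_proj \<lparr>pverts = V, parcs = E\<rparr>)) \<longleftrightarrow> (u, v) \<in> E \<or> (v, u) \<in> E"
proof -
  have "parcs (mk_symmetric (with_proj \<lparr>pverts = V, parcs = E\<rparr>)) = E \<union> E\<inverse>"
    by (auto simp: parcs_mk_symmetric)
  then show ?thesis by simp
qed

lemma octquad_ring_arc_iff:
  fixes \<tau> n
  defines "E \<equiv> \<lambda>i b j c. (1 \<le> i \<and> i < 4 * n \<and> j = i + 1 \<and> c = b) \<or>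
                      (1 \<le> i \<and> i \<le> 4 * n \<and> rung (i, b) \<and> j = i \<and> \<not> b \<and> c) \<or>
                      (i = 4 * n \<and> j = 1 \<and> c = (b \<noteq> \<tau>))"
  assumes "n \<ge> 1"
  shows "((i, b), (j, c)) \<in> parcs (octquad_ring \<tau> n) \<longleftrightarrow> E i b j c \<or> E j c i b"
proof -
  have edge: "((i, b), (j, c)) \<in> octquad_edges n \<union> {((4 * n, False), (1, \<tau>)), ((4 * n, True), (1, \<not> \<tau>))}
          \<longleftrightarrow> E i b j c" for i b j c
    using assms(2) unfolding E_def octquad_edges_def by (cases b) auto
  show ?thesis
    unfolding octquad_ring_def mk_symmetric_arc_iff edge by (rule refl)
qed

text \<open>
  Both indices of an arc are constrained in its description, while a neighbour is computed from
  one of them; the range of the first index turns the one description into the other.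
\<close>

lemma octquad_ring_neighbours:
  assumes "n \<ge> 1" "u \<in> octquad_verts n"
  shows "{w. (u, w) \<in> parcs (octquad_ring \<tau> n)} =
         {nxt \<tau> n u, prv \<tau> n u} \<union> (if rung u then {flip u} else {})"
proof (cases u)
  case (Pair i b)
  then have i: "1 \<le> i" "i \<le> 4 * n"
    using assms by (auto simp: octquad_verts_def)
  have pair: "((i, b), (j, c)) \<in> parcs (octquad_ring \<tau> n) \<longleftrightarrow>
        (j, c) = nxt \<tau> n u \<or> (j, c) = prv \<tau> n u \<or> rung u \<and> (j, c) = flip u" for j c
  proof -
    have "1 \<le> j \<and> j < 4 * n \<and> i = j + 1 \<and> b = c \<longleftrightarrow> i \<noteq> 1 \<and> j = i - 1 \<and> c = b"
      using i by auto
    moreover have "1 \<le> i \<and> i < 4 * n \<and> j = i + 1 \<and> c = b \<longleftrightarrow> i \<noteq> 4 * n \<and> j = i + 1 \<and> c = b"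
      using i by auto
    moreover have "(1 \<le> i \<and> i \<le> 4 * n \<and> rung (i, b) \<and> j = i \<and> \<not> b \<and> c) \<or>
        (1 \<le> j \<and> j \<le> 4 * n \<and> rung (j, c) \<and> i = j \<and> \<not> c \<and> b) \<longleftrightarrow>
        rung (i, b) \<and> j = i \<and> c = (\<not> b)"
      using i by auto
    moreover have "(j = 4 * n \<and> i = 1 \<and> b = (c \<noteq> \<tau>)) = (i = 1 \<and> j = 4 * n \<and> c = (b \<noteq> \<tau>))"
      by auto
    ultimately show ?thesis
      unfolding octquad_ring_arc_iff[OF assms(1)] Pair nxt.simps prv.simps flip.simps
      by (simp only: prod.inject split: if_split) argo
  qed
  have "(u, w) \<in> parcs (octquad_ring \<tau> n) \<longleftrightarrow> w = nxt \<tau> n u \<or> w = prv \<tau> n u \<or> rung u \<and> w = flip u" for w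
    using pair[of "fst w" "snd w"] unfolding Pair by (simp only: prod.collapse)
  then show ?thesis by auto
qed

lemma sum_octquad_ring_neighbours:
  fixes f :: "nat \<times> bool \<Rightarrow> real"
  assumes "n \<ge> 1" "u \<in> octquad_verts n"
  shows "(\<Sum>w | (u, w) \<in> parcs (octquad_ring \<tau> n). f w) =
         f (nxt \<tau> n u) + f (prv \<tau> n u) + (if rung u then f (flip u) else 0)"
proof -
  have "nxt \<tau> n u \<noteq> prv \<tau> n u" "nxt \<tau> n u \<noteq> flip u" "prv \<tau> n u \<noteq> flip u"
    using assms by (cases u; auto simp: octquad_verts_def)+
  then show ?thesis
    unfolding octquad_ring_neighbours[OF assms] by (simp add: Un_insert_left)
qed

section \<open>Distances\<close>

lemma (in wf_digraph) awalk_cost_unit [simp]: "awalk_cost (\<lambda>_. 1) p = real (length p)"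
  by (induction p) auto

definition reach_within :: "'a pair_pre_digraph \<Rightarrow> nat \<Rightarrow> 'a \<Rightarrow> 'a \<Rightarrow> bool" where
  "reach_within G k u v \<longleftrightarrow> (\<exists>p. pre_digraph.awalk (with_proj G) u p v \<and> length p \<le> k)"

text \<open>
  A finite upper bound is what keeps the infimum over all walks away from \<open>\<infinity>\<close>, which the
  conversion to a real number would send to \<open>0\<close>.
\<close>

lemma graph_dist_bounds:
  assumes "pair_wf_digraph G"
    and upper: "reach_within G m u v"
    and lower: "\<And>p. pre_digraph.awalk (with_proj G) u p v \<Longrightarrow> k \<le> length p"
  shows "real k \<le> graph_dist G u v" "graph_dist G u v \<le> real m"
proof -
  interpret G: wf_digraph "with_proj G"
    using assms(1) by (simp add: wf_digraph_wp_iff)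
  obtain p where p: "G.awalk u p v" "length p \<le> m"
    using upper unfolding reach_within_def by blast
  have "G.\<mu> (\<lambda>_. 1) u v \<le> ereal (real (length p))"
    using G.min_cost_le_walk_cost[OF p(1), of "\<lambda>_. 1"] by simp
  also have "\<dots> \<le> ereal (real m)"
    using p(2) by simp
  finally have le: "G.\<mu> (\<lambda>_. 1) u v \<le> ereal (real m)" .
  have ge: "ereal (real k) \<le> G.\<mu> (\<lambda>_. 1) u v"
    unfolding G.\<mu>_def by (rule INF_greatest) (use lower in simp)
  obtain r where "G.\<mu> (\<lambda>_. 1) u v = ereal r"
    using le ge by (cases "G.\<mu> (\<lambda>_. 1) u v") auto
  then show "real k \<le> graph_dist G u v" "graph_dist G u v \<le> real m"
    using le ge by (simp_all add: graph_dist_def)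
qed

lemma reach_within_refl: "u \<in> pverts G \<Longrightarrow> reach_within G 0 u u"
  unfolding reach_within_def by (auto simp: pre_digraph.awalk_def pre_digraph.cas.simps intro!: exI[of _ "[]"])

lemma reach_within_trans:
  assumes "pair_wf_digraph G" "reach_within G k u v" "reach_within G l v w"
  shows "reach_within G (k + l) u w"
proof -
  interpret G: wf_digraph "with_proj G"
    using assms(1) by (simp add: wf_digraph_wp_iff)
  show ?thesis
    using assms(2,3) G.awalk_appendI unfolding reach_within_def
    by (metis add_mono length_append)
qed

lemma reach_within_arc:
  assumes "pair_wf_digraph G" "(u, v) \<in> parcs G"
  shows "reach_within G 1 u v"
proof -
  interpret G: wf_digraph "with_proj G"
    using assms(1) by (simp add: wf_digraph_wp_iff)
  show ?thesis
    unfolding reach_within_def using G.arc_implies_awalk[of "(u, v)"] assms(2)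
    by (auto intro!: exI[of _ "[(u, v)]"])
qed

lemma pair_graph_imp_pair_wf_digraph: "pair_graph G \<Longrightarrow> pair_wf_digraph G"
proof -
  assume "pair_graph G"
  then interpret pair_graph G .
  show ?thesis by unfold_locales
qed

lemma pair_graph_sym_arc: "pair_graph G \<Longrightarrow> (u, v) \<in> parcs G \<Longrightarrow> (v, u) \<in> parcs G"
proof -
  assume "pair_graph G" and uv: "(u, v) \<in> parcs G"
  then interpret pair_graph G by simp
  show ?thesis using uv by (rule arcs_symmetric)
qed

lemma reach_within_sym:
  assumes "pair_graph G" "reach_within G k u v"
  shows "reach_within G k v u"
proof -
  have wf: "pair_wf_digraph G"
    using assms(1) by (rule pair_graph_imp_pair_wf_digraph)
  then interpret G: wf_digraph "with_proj G"
    by (simp add: wf_digraph_wp_iff)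
  have "reach_within G (length p) v u" if "G.awalk u p v" for p
    using that
  proof (induction p arbitrary: u)
    case Nil
    then show ?case by (auto simp: G.awalk_Nil_iff reach_within_refl)
  next
    case (Cons e p)
    then have e: "e \<in> parcs G" "u = fst e" "G.awalk (snd e) p v"
      by (simp_all add: G.awalk_Cons_iff)
    then have "(snd e, u) \<in> parcs G"
      using pair_graph_sym_arc[OF assms(1), of u "snd e"] by simp
    then show ?case
      using reach_within_trans[OF wf Cons.IH[OF e(3)] reach_within_arc[OF wf]] by simp
  qed
  then show ?thesis
    using assms(2) unfolding reach_within_def by (meson order_trans)
qed

text \<open>
  Truncated subtraction makes one of the summands vanish. The distance of two columns on the cycle
  of length \<open>L\<close> is the smaller of \<open>gap i j\<close> and \<open>L - gap i j\<close>.
\<close>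

definition gap :: "nat \<Rightarrow> nat \<Rightarrow> nat" where
  "gap i j = (i - j) + (j - i)"

lemma octquad_ring_arcs:
  assumes "n \<ge> 1" "u \<in> octquad_verts n"
  shows "(u, nxt \<tau> n u) \<in> parcs (octquad_ring \<tau> n)"
    "rung u \<Longrightarrow> (u, flip u) \<in> parcs (octquad_ring \<tau> n)"
  using octquad_ring_neighbours[OF assms, of \<tau>] by (auto split: if_splits)

text \<open>
  One walks to the right column the shorter way round, on whichever side the walk happens to
  arrive, and then changes sides if necessary. Every column has a rung or is next to one that does,
  so the change costs at most three arcs.
\<close>

lemma octquad_ring_reach_within:
  assumes n: "n \<ge> 1" and i: "1 \<le> i" "i \<le> 4 * n" and j: "1 \<le> j" "j \<le> 4 * n"
  shows "reach_within (octquad_ring \<tau> n) (min (gap i j) (4 * n - gap i j) + 3) (i, b) (j, c)"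
proof -
  let ?G = "octquad_ring \<tau> n"
  have G: "pair_graph ?G" using n by (rule pair_graph_octquad_ring)
  then have wf: "pair_wf_digraph ?G" by (rule pair_graph_imp_pair_wf_digraph)
  note trans = reach_within_trans[OF wf] and arc = reach_within_arc[OF wf]
    and sym = reach_within_sym[OF G] and arcs = octquad_ring_arcs[OF n]
  have forward: "reach_within ?G (l - k) (k, b) (l, b)"
    if "k \<le> l" "1 \<le> k" "l \<le> 4 * n" for k l b
    using that
  proof (induction l rule: dec_induct)
    case base
    then show ?case by (simp add: reach_within_refl)
  next
    case (step l)
    have "((l, b), (l + 1, b)) \<in> parcs ?G"
      using arcs(1)[of "(l, b)"] step by auto
    from trans[OF step.IH arc[OF this]] show ?case
      using step by (simp add: Suc_diff_le)
  qed
  have around: "reach_within ?G (4 * n - (l - k)) (l, b) (k, b \<noteq> \<tau>)"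
    if "k \<le> l" "1 \<le> k" "l \<le> 4 * n" for k l b
  proof -
    have "((4 * n, b), (1, b \<noteq> \<tau>)) \<in> parcs ?G"
      using arcs(1)[of "(4 * n, b)"] n by auto
    from trans[OF trans[OF forward[of l "4 * n"] arc[OF this]] forward[of 1 k]]
    have "reach_within ?G (4 * n - l + 1 + (k - 1)) (l, b) (k, b \<noteq> \<tau>)"
      using that by simp
    moreover have "4 * n - l + 1 + (k - 1) = 4 * n - (l - k)"
      using that by simp
    ultimately show ?thesis by (simp only:)
  qed
  have switch: "reach_within ?G 3 (j, b) (j, c)" for b c
  proof (cases "b = c")
    case True
    have "reach_within ?G 0 (j, b) (j, c)" using True j by (simp add: reach_within_refl)
    then show ?thesis unfolding reach_within_def by force
  next
    case False
    then have c: "c = (\<not> b)" by auto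
    have "rung (j, b) \<or> j mod 4 = 2 \<or> j mod 4 = 3"
      unfolding rung.simps by presburger
    then consider "rung (j, b)" | "j mod 4 = 2" | "j mod 4 = 3"
      by blast
    then show ?thesis
    proof cases
      case 1
      then have "reach_within ?G 1 (j, b) (j, c)"
        using arc[OF arcs(2)[of "(j, b)"]] j by (simp add: c)
      then show ?thesis unfolding reach_within_def by force
    next
      case 2
      then obtain m where "j = 4 * m + 2"
        by (metis mult_div_mod_eq)
      then have j2: "1 \<le> j - 1" "j - 1 \<le> j" "rung (j - 1, b)" "j - (j - 1) = 1"
        using j by auto
      have "reach_within ?G 1 (j - 1, b) (j - 1, c)"
        using arc[OF arcs(2)[of "(j - 1, b)"]] j j2 by (simp add: c)
      from trans[OF trans[OF sym[OF forward[of "j - 1" j b]] this] forward[of "j - 1" j c]]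
      show ?thesis using j j2 by (simp add: numeral_3_eq_3)
    next
      case 3
      then obtain m where m: "j = 4 * m + 3"
        by (metis mult_div_mod_eq)
      then have "j + 1 = 4 * (m + 1)" by simp
      then have j3: "j + 1 \<le> 4 * n" "rung (j + 1, b)"
        using j m by (arith, simp del: mult_Suc_right)
      have "reach_within ?G 1 (j + 1, b) (j + 1, c)"
        using arc[OF arcs(2)[of "(j + 1, b)"]] j3 by (simp add: c)
      from trans[OF trans[OF forward[of j "j + 1" b] this] sym[OF forward[of j "j + 1" c]]]
      show ?thesis using j j3 by (simp add: numeral_3_eq_3)
    qed
  qed
  have "\<exists>b'. reach_within ?G (gap i j) (i, b) (j, b')"
    using forward[of i j b] sym[OF forward[of j i b]] i j by (cases "i \<le> j") (auto simp: gap_def)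
  moreover have "\<exists>b'. reach_within ?G (4 * n - gap i j) (i, b) (j, b')"
    using around[of j i b] sym[OF around[of i j "b \<noteq> \<tau>"]] i j
    by (cases "i \<le> j"; cases \<tau>; auto simp: gap_def)
  ultimately have "\<exists>b'. reach_within ?G (min (gap i j) (4 * n - gap i j)) (i, b) (j, b')"
    by (simp add: min_def)
  then show ?thesis
    using trans[OF _ switch] by blast
qed

text \<open>
  Forgetting the side maps the network onto the cycle of its columns, and the cyclic distance to a
  fixed column changes by at most one along an arc.
\<close>

lemma octquad_ring_walk_length:
  assumes n: "n \<ge> 1" and k: "1 \<le> k" "k \<le> 4 * n"
    and walk: "pre_digraph.awalk (with_proj (octquad_ring \<tau> n)) (i, b) p (k, c)"
  shows "min (gap i k) (4 * n - gap i k) \<le> length p"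
proof -
  let ?G = "octquad_ring \<tau> n"
  interpret G: wf_digraph "with_proj ?G"
    using pair_graph_imp_pair_wf_digraph[OF pair_graph_octquad_ring[OF n]] by (simp add: wf_digraph_wp_iff)
  have lipschitz: "min (gap i k) (4 * n - gap i k) \<le> min (gap j k) (4 * n - gap j k) + 1"
    if "((i, b), (j, c)) \<in> parcs ?G" for i j b c
  proof -
    have step: "gap i k \<le> gap (i + 1) k + 1" "gap (i + 1) k \<le> gap i k + 1" for i
      by (simp_all add: gap_def)
    \<comment> \<open>Across the seam the two gaps are complementary up to one, so the minimum changes by at most one.\<close>
    have wrap: "gap (4 * n) k + gap 1 k = 4 * n - 1" "gap 1 k < 4 * n" "gap (4 * n) k < 4 * n"
      using k by (simp_all add: gap_def)
    have "j = i + 1 \<or> i = j + 1 \<or> i = j \<or> i = 4 * n \<and> j = 1 \<or> j = 4 * n \<and> i = 1"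
      using that unfolding octquad_ring_arc_iff[OF n] by blast
    then have "gap i k \<le> gap j k + 1 \<and> gap j k \<le> gap i k + 1 \<or>
        gap i k + gap j k = 4 * n - 1 \<and> gap j k < 4 * n"
      using step[of i] step[of j] wrap by (metis add.commute le_add1)
    then show ?thesis
      unfolding min_def by (auto; linarith)
  qed
  show ?thesis
    using walk
  proof (induction p arbitrary: i b)
    case Nil
    then show ?case by (simp add: G.awalk_Nil_iff gap_def)
  next
    case (Cons e p)
    then obtain j b' where e: "((i, b), (j, b')) \<in> parcs ?G" "G.awalk (j, b') p (k, c)"
      by (cases e) (auto simp: G.awalk_Cons_iff)
    show ?case
      using lipschitz[OF e(1)] Cons.IH[OF e(2)] by simp
  qed
qed

lemma octquad_ring_graph_dist_approx:
  assumes n: "n \<ge> 1" and "u \<in> octquad_verts n" "v \<in> octquad_verts n"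
  shows "\<bar>graph_dist (octquad_ring \<tau> n) u v
            - real (min (gap (fst u) (fst v)) (4 * n - gap (fst u) (fst v)))\<bar> \<le> 3"
proof -
  obtain i b j c where [simp]: "u = (i, b)" "v = (j, c)" by (cases u, cases v) auto
  have wf: "pair_wf_digraph (octquad_ring \<tau> n)"
    using pair_graph_imp_pair_wf_digraph[OF pair_graph_octquad_ring[OF n]] .
  have upper: "reach_within (octquad_ring \<tau> n) (min (gap i j) (4 * n - gap i j) + 3) (i, b) (j, c)"
    using octquad_ring_reach_within[OF n] assms by simp
  have lower: "min (gap i j) (4 * n - gap i j) \<le> length p"
    if "pre_digraph.awalk (with_proj (octquad_ring \<tau> n)) (i, b) p (j, c)" for p
    using octquad_ring_walk_length[OF n _ _ that] assms by simp
  show ?thesis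
    using graph_dist_bounds[OF wf upper lower] by simp
qed

section \<open>Potentials and effective resistance\<close>

lemma laplacian_self_adjoint:
  fixes f h :: "'a \<Rightarrow> real"
  assumes G: "pair_graph G"
  shows "(\<Sum>u\<in>pverts G. f u * (\<Sum>w | (u, w) \<in> parcs G. h u - h w)) =
      (\<Sum>u\<in>pverts G. h u * (\<Sum>w | (u, w) \<in> parcs G. f u - f w))"
proof -
  interpret pair_graph G by fact
  have fin: "finite (pverts G)" "finite (parcs G)"
    by (rule pair_finite_verts, rule pair_finite_arcs)
  have fin_out: "finite {w. (u, w) \<in> parcs G}" for u
    by (rule finite_subset[OF _ finite_imageI[OF fin(2), of snd]]) (force simp: image_iff)
  have pairing: "(\<Sum>u\<in>pverts G. f u * (\<Sum>w | (u, w) \<in> parcs G. h u - h w)) =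
      (\<Sum>(u, w)\<in>parcs G. f u * (h u - h w))" for f h :: "'a \<Rightarrow> real"
  proof -
    have "(\<Sum>u\<in>pverts G. f u * (\<Sum>w | (u, w) \<in> parcs G. h u - h w)) =
        (\<Sum>(u, w)\<in>(SIGMA u:pverts G. {w. (u, w) \<in> parcs G}). f u * (h u - h w))"
      using fin fin_out by (simp add: sum_distrib_left sum.Sigma)
    also have "(SIGMA u:pverts G. {w. (u, w) \<in> parcs G}) = parcs G"
      using arc_fst_in_verts by force
    finally show ?thesis .
  qed
  have swap: "(\<Sum>(u, w)\<in>parcs G. F u w) = (\<Sum>(u, w)\<in>parcs G. F w u)" for F :: "'a \<Rightarrow> 'a \<Rightarrow> real"
    by (rule sum.reindex_bij_witness[of _ prod.swap prod.swap])
       (auto intro: pair_graph_sym_arc[OF G])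
  have "(\<Sum>(u, w)\<in>parcs G. f u * (h u - h w)) - (\<Sum>(u, w)\<in>parcs G. h u * (f u - f w)) =
      (\<Sum>(u, w)\<in>parcs G. h u * f w) - (\<Sum>(u, w)\<in>parcs G. f u * h w)"
    by (simp add: sum_subtractf[symmetric] case_prod_unfold algebra_simps)
  then show ?thesis
    unfolding pairing using swap[of "\<lambda>u w. h u * f w"] by (simp add: mult.commute)
qed

text \<open>
  Any potential may be used to read off the resistance. If \<open>\<phi>\<close> and \<open>\<psi>\<close> are two of them and \<open>\<Delta>\<close> is
  the Laplacian, then \<open>\<phi> s - \<phi> t\<close> is the pairing of \<open>\<phi>\<close> with \<open>\<Delta> \<psi>\<close>, and \<open>\<psi> s - \<psi> t\<close> that of \<open>\<psi>\<close> with
  \<open>\<Delta> \<phi>\<close>; these agree because the Laplacian is self-adjoint.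
\<close>

lemma resistance_dist_eq:
  assumes G: "pair_graph G" and s: "s \<in> pverts G" and t: "t \<in> pverts G"
    and pot: "unit_current_potential G s t \<phi>"
  shows "resistance_dist G s t = \<phi> s - \<phi> t"
proof -
  interpret pair_graph G by fact
  have drop: "(\<Sum>u\<in>pverts G. f u * (\<Sum>w | (u, w) \<in> parcs G. h u - h w)) = f s - f t"
    if "unit_current_potential G s t h" for f h
  proof -
    have "(\<Sum>u\<in>pverts G. f u * (\<Sum>w | (u, w) \<in> parcs G. h u - h w)) =
        (\<Sum>u\<in>pverts G. f u * of_bool (u = s) - f u * of_bool (u = t))"
      using that by (intro sum.cong) (auto simp: unit_current_potential_def right_diff_distrib)
    also have "\<dots> = f s - f t"
    proof -
      have "(\<Sum>u\<in>pverts G. f u * of_bool (u = a)) = f a" if "a \<in> pverts G" for a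
        using that pair_finite_verts by (simp add: of_bool_def if_distrib cong: if_cong)
      then show ?thesis using s t by (simp add: sum_subtractf)
    qed
    finally show ?thesis .
  qed
  show ?thesis
    unfolding resistance_dist_def
  proof (rule the_equality)
    show "\<exists>\<psi>. unit_current_potential G s t \<psi> \<and> \<phi> s - \<phi> t = \<psi> s - \<psi> t"
      using pot by blast
    fix r
    assume "\<exists>\<psi>. unit_current_potential G s t \<psi> \<and> r = \<psi> s - \<psi> t"
    then obtain \<psi> where \<psi>: "unit_current_potential G s t \<psi>" "r = \<psi> s - \<psi> t" by blast
    show "r = \<phi> s - \<phi> t"
      using drop[OF pot, of \<psi>] drop[OF \<psi>(1), of \<phi>] laplacian_self_adjoint[OF G, of \<phi> \<psi>] \<psi>(2) by simp
  qed
qed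

section \<open>The even part of the potential: the cycle of columns\<close>

text \<open>
  The effective resistance of two vertices at distance \<open>d\<close> on a cycle of \<open>L\<close> edges of resistance
  \<open>1 / 2\<close> each: arcs of resistance \<open>d / 2\<close> and \<open>(L - d) / 2\<close> in parallel. The two sides of the network
  amount to such halved edges.
\<close>

definition cycle_resistance :: "nat \<Rightarrow> nat \<Rightarrow> real" where
  "cycle_resistance L d = real d * (real L - real d) / (2 * real L)"

text \<open>
  As a function of the column this is the negative of a Green function of the cycle, a parabola with
  a kink at \<open>k\<close>. The constant \<open>1 / L\<close> cancels when the functions of two columns are subtracted.
  The parabola is symmetric about \<open>L / 2\<close>, so it closes up across the seam.
\<close>

lemma cycle_resistance_second_difference:
  assumes k: "1 \<le> k" "k \<le> L" and i: "1 \<le> i" "i \<le> L"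
  shows "2 * cycle_resistance L (gap i k)
           - cycle_resistance L (gap (if i = L then 1 else i + 1) k)
           - cycle_resistance L (gap (if i = 1 then L else i - 1) k)
         = 1 / real L - of_bool (i = k)"
proof -
  let ?q = "\<lambda>d::real. d * (real L - d) / (2 * real L)"
  have L: "real L > 0" using k by simp
  have gap: "cycle_resistance L (gap i k) = ?q \<bar>real i - real k\<bar>" for i
    by (simp add: cycle_resistance_def gap_def abs_if of_nat_diff)
  have reflect: "?q (real L - d) = ?q d" for d
    by (simp add: mult.commute)
  have next': "cycle_resistance L (gap (if i = L then 1 else i + 1) k) = ?q \<bar>real i + 1 - real k\<bar>"
  proof (cases "i = L")
    case True
    have "\<bar>1 - real k\<bar> = real L - \<bar>real i + 1 - real k\<bar>" using True k by simp
    then show ?thesis unfolding gap using True reflect[of "\<bar>real i + 1 - real k\<bar>"] by (simp only: simp_thms if_True of_nat_1)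
  qed (simp add: gap add.commute)
  have prev: "cycle_resistance L (gap (if i = 1 then L else i - 1) k) = ?q \<bar>real i - 1 - real k\<bar>"
  proof (cases "i = 1")
    case True
    have "\<bar>real L - real k\<bar> = real L - \<bar>real i - 1 - real k\<bar>" using True k by simp
    then show ?thesis unfolding gap using True reflect[of "\<bar>real i - 1 - real k\<bar>"] by (simp only: simp_thms if_True)
  qed (use i in \<open>simp add: gap of_nat_diff\<close>)
  consider "i = k" | "real i \<ge> real k + 1" | "real i \<le> real k - 1"
    using nat_neq_iff[of i k] by force
  then have "2 * ?q \<bar>real i - real k\<bar> - ?q \<bar>real i + 1 - real k\<bar> - ?q \<bar>real i - 1 - real k\<bar>
      = 1 / real L - of_bool (i = k)"
  proof cases
    case 1
    then show ?thesis using L by (simp add: field_simps)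
  next
    case 2
    then have "\<bar>real i - real k\<bar> = real i - real k" "\<bar>real i + 1 - real k\<bar> = real i + 1 - real k"
      "\<bar>real i - 1 - real k\<bar> = real i - 1 - real k" "i \<noteq> k" by auto
    then show ?thesis using L by (simp add: field_simps)
  next
    case 3
    then have "\<bar>real i - real k\<bar> = real k - real i" "\<bar>real i + 1 - real k\<bar> = real k - real i - 1"
      "\<bar>real i - 1 - real k\<bar> = real k - real i + 1" "i \<noteq> k" by auto
    then show ?thesis using L by (simp add: field_simps)
  qed
  then show ?thesis unfolding gap[of i] next' prev .
qed

section \<open>The odd part of the potential: uniform boundedness\<close>

text \<open>
  The equation is solved by its Neumann series, which a geometric series dominates in the supremum
  norm with weight \<open>g\<close>. Each term, and hence the sum, inherits oddness under \<open>\<sigma>\<close> from \<open>f\<close>.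
\<close>

lemma weighted_contraction_solution:
  fixes c f g :: "'a \<Rightarrow> real" and \<alpha> \<beta> :: "'a \<Rightarrow> 'a"
  assumes c: "\<And>v. c v \<ge> 0"
    and contr: "\<And>v. c v * (g (\<alpha> v) + g (\<beta> v)) \<le> r * g v" and r: "0 \<le> r" "r < 1"
    and f: "\<And>v. \<bar>f v\<bar> \<le> M * g v" and M: "M \<ge> 0"
    and odd: "\<And>v. \<alpha> (\<sigma> v) = \<sigma> (\<alpha> v)" "\<And>v. \<beta> (\<sigma> v) = \<sigma> (\<beta> v)" "\<And>v. c (\<sigma> v) = c v"
      "\<And>v. f (\<sigma> v) = - f v"
  obtains h where "\<And>v. h v = f v + c v * (h (\<alpha> v) + h (\<beta> v))"
    "\<And>v. \<bar>h v\<bar> \<le> M * g v / (1 - r)" "\<And>v. h (\<sigma> v) = - h v"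
proof -
  define T where "T h v = c v * (h (\<alpha> v) + h (\<beta> v))" for h v
  define a where "a k = (T ^^ k) f" for k
  have a_0: "a 0 = f" and a_Suc: "a (Suc k) v = c v * (a k (\<alpha> v) + a k (\<beta> v))" for k v
    by (simp_all add: a_def T_def)
  have bound: "\<bar>a k v\<bar> \<le> r ^ k * (M * g v)" for k v
  proof (induction k arbitrary: v)
    case 0
    then show ?case using f by (simp add: a_0)
  next
    case (Suc k)
    have "\<bar>a (Suc k) v\<bar> \<le> c v * (\<bar>a k (\<alpha> v)\<bar> + \<bar>a k (\<beta> v)\<bar>)"
      unfolding a_Suc abs_mult using c[of v] by (simp add: mult_left_mono)
    also have "\<dots> \<le> c v * (r ^ k * (M * g (\<alpha> v)) + r ^ k * (M * g (\<beta> v)))"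
      using Suc.IH c by (intro mult_left_mono add_mono) auto
    also have "\<dots> = r ^ k * M * (c v * (g (\<alpha> v) + g (\<beta> v)))"
      by (simp add: algebra_simps)
    also have "\<dots> \<le> r ^ k * M * (r * g v)"
      using contr r M by (intro mult_left_mono) auto
    finally show ?case by (simp add: algebra_simps)
  qed
  have geo: "(\<lambda>k. r ^ k * (M * g v)) sums (M * g v / (1 - r))" for v
    using sums_mult2[OF geometric_sums[of r], of "M * g v"] r by simp
  have summable: "summable (\<lambda>k. a k v)" for v
    by (rule summable_comparison_test'[OF sums_summable[OF geo[of v]]]) (use bound in simp)
  have odd_a: "a k (\<sigma> v) = - a k v" for k v
    by (induction k arbitrary: v) (simp_all add: a_0 a_Suc odd algebra_simps)
  show ?thesis
  proof (rule that[of "\<lambda>v. \<Sum>k. a k v"])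
    fix v
    have "(\<Sum>k. a k v) = a 0 v + (\<Sum>k. a (Suc k) v)"
      using suminf_split_head[OF summable[of v]] by simp
    also have "(\<Sum>k. a (Suc k) v) = c v * ((\<Sum>k. a k (\<alpha> v)) + (\<Sum>k. a k (\<beta> v)))"
      unfolding a_Suc by (simp add: suminf_add suminf_mult summable summable_add)
    finally show "(\<Sum>k. a k v) = f v + c v * ((\<Sum>k. a k (\<alpha> v)) + (\<Sum>k. a k (\<beta> v)))"
      by (simp add: a_0)
    have "summable (\<lambda>k. \<bar>a k v\<bar>)"
      by (rule summable_comparison_test'[OF sums_summable[OF geo[of v]]]) (use bound in simp)
    then have "\<bar>\<Sum>k. a k v\<bar> \<le> (\<Sum>k. r ^ k * (M * g v))"
      using summable_rabs suminf_le[OF bound _ sums_summable[OF geo[of v]]] by (meson order_trans)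
    then show "\<bar>\<Sum>k. a k v\<bar> \<le> M * g v / (1 - r)"
      using geo[of v] by (simp add: sums_iff)
    show "(\<Sum>k. a k (\<sigma> v)) = - (\<Sum>k. a k v)"
      by (simp add: odd_a suminf_minus summable)
  qed
qed

text \<open>
  For an odd function \<open>h\<close> the rung adds \<open>2 h\<close> to the Laplacian, so the diagonal coefficient is \<open>4\<close> at a
  rung and \<open>2\<close> elsewhere, that is \<open>4 / weight\<close>. The unweighted averaging at vertices without
  a rung is no contraction; weighing them twice as much makes it one.
\<close>

definition weight :: "nat \<times> bool \<Rightarrow> real" where
  "weight v = (if rung v then 1 else 2)"

lemma rung_flip [simp]: "rung (flip v) \<longleftrightarrow> rung v"
  by (cases v) simp

text \<open>
  Adjacent pairs of columns with a rung and without one alternate, so at least one of the two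
  neighbouring columns has a rung. The pattern modulo \<open>4\<close> continues beyond the vertices, so that the
  averaging equation can be solved on the whole type.
\<close>

lemma weight_neighbours: "weight (nxt \<tau> n v) + weight (prv \<tau> n v) \<le> 3"
proof (cases v)
  case (Pair i b)
  have nxt: "rung (nxt \<tau> n v) \<longleftrightarrow> (i + 1) mod 4 = 0 \<or> (i + 1) mod 4 = 1"
    by (auto simp: Pair mod_Suc)
  have prv: "rung (prv \<tau> n v) \<longleftrightarrow> (i - 1) mod 4 = 0 \<or> (i - 1) mod 4 = 1"
    by (auto simp: Pair)
  have "rung (nxt \<tau> n v) \<or> rung (prv \<tau> n v)"
    unfolding nxt prv by (cases i) (simp, simp, presburger)
  then show ?thesis by (auto simp: weight_def)
qed

text \<open>
  Dividing by the diagonal coefficient gives an averaging equation, which contracts the weighted norm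
  by \<open>3 / 4\<close> since neighbouring weights add up to at most \<open>3\<close>. The bound \<open>2\<close> depends neither
  on \<open>n\<close> nor on the way the network is closed.
\<close>

lemma octquad_ring_odd_potential:
  fixes F :: "nat \<times> bool \<Rightarrow> real"
  assumes F: "\<And>v. \<bar>F v\<bar> \<le> 1" "\<And>v. F (flip v) = - F v"
  obtains h where
    "\<And>v. (2 + 2 * of_bool (rung v)) * h v - h (nxt \<tau> n v) - h (prv \<tau> n v) = F v"
    "\<And>v. \<bar>h v\<bar> \<le> 2" "\<And>v. h (flip v) = - h v"
proof -
  have flip: "nxt \<tau> n (flip v) = flip (nxt \<tau> n v)" "prv \<tau> n (flip v) = flip (prv \<tau> n v)"
    "weight (flip v) = weight v" for v
    by (cases v; auto simp: weight_def)+
  have nonneg: "weight v \<ge> 0" for v by (simp add: weight_def)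
  obtain h where h: "\<And>v. h v = weight v / 4 * F v + weight v / 4 * (h (nxt \<tau> n v) + h (prv \<tau> n v))"
    "\<And>v. \<bar>h v\<bar> \<le> 1 / 4 * weight v / (1 - 3 / 4)" "\<And>v. h (flip v) = - h v"
  proof (rule weighted_contraction_solution[of "\<lambda>v. weight v / 4" weight "nxt \<tau> n" "prv \<tau> n" "3 / 4"
        "\<lambda>v. weight v / 4 * F v" "1 / 4" flip])
    show "weight v / 4 * (weight (nxt \<tau> n v) + weight (prv \<tau> n v)) \<le> 3 / 4 * weight v" for v
      using mult_left_mono[OF weight_neighbours[of \<tau> n v] nonneg[of v]] by simp
    show "\<bar>weight v / 4 * F v\<bar> \<le> 1 / 4 * weight v" for v
      using mult_left_mono[OF F(1)[of v] nonneg[of v]] nonneg[of v] by (simp add: abs_mult)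
    show "0 \<le> weight v / 4" "nxt \<tau> n (flip v) = flip (nxt \<tau> n v)"
      "prv \<tau> n (flip v) = flip (prv \<tau> n v)" "weight (flip v) / 4 = weight v / 4"
      "weight (flip v) / 4 * F (flip v) = - (weight v / 4 * F v)" for v
      using nonneg[of v] by (simp_all add: flip F(2))
    show "(0 :: real) \<le> 3 / 4" "(3 / 4 :: real) < 1" "(0 :: real) \<le> 1 / 4" by simp_all
  qed (rule that)
  show ?thesis
  proof (rule that[of h])
    fix v
    show "(2 + 2 * of_bool (rung v)) * h v - h (nxt \<tau> n v) - h (prv \<tau> n v) = F v"
    proof (cases "rung v")
      case True
      then have "weight v = 1" "2 + 2 * of_bool (rung v) = (4 :: real)" by (simp_all add: weight_def)
      note w = this
      show ?thesis using h(1)[of v] unfolding w by (simp add: field_simps)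
    next
      case False
      then have "weight v = 2" "2 + 2 * of_bool (rung v) = (2 :: real)" by (simp_all add: weight_def)
      note w = this
      show ?thesis using h(1)[of v] unfolding w by (simp add: field_simps)
    qed
    show "\<bar>h v\<bar> \<le> 2"
      using h(2)[of v] by (simp add: weight_def split: if_splits)
    show "h (flip v) = - h v" by (rule h(3))
  qed
qed

text \<open>
  A unit current from \<open>s\<close> to \<open>t\<close> is the sum of half the current from both vertices of the column of \<open>s\<close>
  to both vertices of the column of \<open>t\<close>, and of an odd remainder. The first drives a potential
  that depends on the column only, where rungs carry no current, and contributes exactly the
  resistance of the cycle; the second contributes \<open>h s - h t\<close>, which is bounded.
\<close>

lemma octquad_ring_resistance_approx:
  assumes n: "n \<ge> 1" and s: "s \<in> octquad_verts n" and t: "t \<in> octquad_verts n"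
  shows "\<bar>resistance_dist (octquad_ring \<tau> n) s t - cycle_resistance (4 * n) (gap (fst s) (fst t))\<bar> \<le> 4"
proof -
  let ?G = "octquad_ring \<tau> n"
  define q where "q i k = cycle_resistance (4 * n) (gap i k)" for i k
  define \<delta> where "\<delta> u v = (of_bool (v = u) :: real)" for u v :: "nat \<times> bool"
  have flip_flip: "flip (flip v) = v" "flip u = v \<longleftrightarrow> u = flip v" for u v
    by (cases u; cases v; auto)+
  \<comment> \<open>the odd part of \<open>\<delta> s - \<delta> t\<close>\<close>
  define F where "F v = (\<delta> s v - \<delta> (flip s) v - \<delta> t v + \<delta> (flip t) v) / 2" for v
  have F_le: "\<bar>F v\<bar> \<le> 1" for v
    by (simp add: F_def \<delta>_def of_bool_def)
  have F_odd: "F (flip v) = - F v" for v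
    by (simp add: F_def \<delta>_def flip_flip)
  obtain h where
    h: "\<And>v. (2 + 2 * of_bool (rung v)) * h v - h (nxt \<tau> n v) - h (prv \<tau> n v) = F v"
      "\<And>v. \<bar>h v\<bar> \<le> 2" "\<And>v. h (flip v) = - h v"
    using octquad_ring_odd_potential[of F \<tau> n, OF F_le F_odd] by blast
  \<comment> \<open>The Laplacian of \<open>\<lambda>i. q i k\<close> has a sink at \<open>k\<close>, which is why \<open>t\<close> takes the positive sign.\<close>
  define \<psi> where "\<psi> i = q i (fst t) - q i (fst s)" for i
  define \<phi> where "\<phi> v = \<psi> (fst v) / 2 + h v" for v
  have "unit_current_potential ?G s t \<phi>"
    unfolding unit_current_potential_def
  proof (intro ballI)
    fix u assume "u \<in> pverts ?G"
    then have u: "u \<in> octquad_verts n" by simp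
    have fst_eq: "\<delta> v u + \<delta> (flip v) u = of_bool (fst u = fst v)" for v
      by (cases u; cases v; auto simp: \<delta>_def)
    have "2 * \<psi> (fst u) - \<psi> (fst (nxt \<tau> n u)) - \<psi> (fst (prv \<tau> n u)) =
        of_bool (fst u = fst s) - of_bool (fst u = fst t)"
    proof -
      have "2 * q (fst u) k - q (fst (nxt \<tau> n u)) k - q (fst (prv \<tau> n u)) k
          = 1 / real (4 * n) - of_bool (fst u = k)" if "1 \<le> k" "k \<le> 4 * n" for k
      proof -
        have "fst (nxt \<tau> n u) = (if fst u = 4 * n then 1 else fst u + 1)"
          "fst (prv \<tau> n u) = (if fst u = 1 then 4 * n else fst u - 1)"
          "1 \<le> fst u" "fst u \<le> 4 * n"
          using u by (cases u; simp)+
        then show ?thesis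
          unfolding q_def using cycle_resistance_second_difference[OF that, of "fst u"] by (simp only:)
      qed
      from this[of "fst s"] this[of "fst t"] show ?thesis
        using s t by (cases s; cases t; simp add: \<psi>_def)
    qed
    moreover have "(\<Sum>w | (u, w) \<in> parcs ?G. \<phi> u - \<phi> w) =
        (2 * \<psi> (fst u) - \<psi> (fst (nxt \<tau> n u)) - \<psi> (fst (prv \<tau> n u))) / 2 + F u"
    proof -
      have "fst (flip u) = fst u" by (cases u) simp
      then show ?thesis
        unfolding sum_octquad_ring_neighbours[OF n u] h(1)[of u, symmetric]
        by (simp add: \<phi>_def h(3) field_simps)
    qed
    ultimately show "(\<Sum>w | (u, w) \<in> parcs ?G. \<phi> u - \<phi> w) = of_bool (u = s) - of_bool (u = t)"
      using fst_eq[of s] fst_eq[of t] by (simp add: F_def \<delta>_def field_simps)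
  qed
  then have "resistance_dist ?G s t = \<phi> s - \<phi> t"
    using s t pair_graph_octquad_ring[OF n] by (intro resistance_dist_eq) auto
  moreover have "q i i = 0" "q i k = q k i" for i k
    by (simp_all add: q_def cycle_resistance_def gap_def add.commute)
  then have "\<phi> s - \<phi> t = q (fst s) (fst t) + (h s - h t)"
    by (simp add: \<phi>_def \<psi>_def)
  ultimately show ?thesis
    using h(2)[of s] h(2)[of t] by (simp add: q_def)
qed

section \<open>Summation over all pairs\<close>

text \<open>
  Seen from any column, the columns lie at the gaps \<open>0, \<dots>, L - 1\<close> going round the cycle one way;
  a function symmetric under reflection cannot tell a gap from its complement.
\<close>

lemma sum_gap:
  fixes F :: "nat \<Rightarrow> real"
  assumes sym: "\<And>d. d \<le> L \<Longrightarrow> F (L - d) = F d" and i: "1 \<le> i" "i \<le> L"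
  shows "(\<Sum>j = 1..L. F (gap i j)) = (\<Sum>d<L. F d)"
proof -
  have split: "{1..L} = {1..i} \<union> {i<..L}" "{..<L} = {..<i} \<union> {i..<L}"
    using i by auto
  have reflect: "F (L + i - j) = F (j - i)" if "i < j" "j \<le> L" for j
    using sym[of "j - i"] that by simp
  have "(\<Sum>j = 1..L. F (gap i j)) = (\<Sum>j = 1..i. F (gap i j)) + (\<Sum>j\<in>{i<..L}. F (gap i j))"
    unfolding split(1) by (rule sum.union_disjoint) auto
  also have "(\<Sum>j = 1..i. F (gap i j)) = (\<Sum>d<i. F d)"
    by (rule sum.reindex_bij_witness[of _ "\<lambda>d. i - d" "\<lambda>j. i - j"]) (auto simp: gap_def)
  also have "(\<Sum>j\<in>{i<..L}. F (gap i j)) = (\<Sum>d = i..<L. F d)"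
    by (rule sum.reindex_bij_witness[of _ "\<lambda>d. L + i - d" "\<lambda>j. L + i - j"])
       (use i reflect in \<open>auto simp: gap_def\<close>)
  also have "(\<Sum>d<i. F d) + (\<Sum>d = i..<L. F d) = (\<Sum>d<L. F d)"
    unfolding split(2) by (rule sum.union_disjoint[symmetric]) auto
  finally show ?thesis .
qed

text \<open>
  There are about \<open>32 n\<^sup>2\<close> pairs, so a bounded error per pair is negligible against index values of
  order \<open>n\<^sup>3\<close>. The factor \<open>8 n\<close> is half of \<open>4 n\<close> columns times four choices of sides. As \<open>F 0 = 0\<close>,
  pairs of equal vertices may be added to the sum.
\<close>

lemma pair_sum_approx:
  fixes F :: "nat \<Rightarrow> real" and D :: "nat \<times> bool \<Rightarrow> nat \<times> bool \<Rightarrow> real"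
  assumes F: "F 0 = 0" "\<And>d. d \<le> 4 * n \<Longrightarrow> F (4 * n - d) = F d"
    and V: "pverts G = octquad_verts n"
    and approx: "\<And>u v. u \<in> octquad_verts n \<Longrightarrow> v \<in> octquad_verts n \<Longrightarrow>
      \<bar>D u v - F (gap (fst u) (fst v))\<bar> \<le> C"
  shows "\<bar>pair_sum G D - 8 * real n * (\<Sum>d<4 * n. F d)\<bar> \<le> 32 * C * (real n)\<^sup>2"
proof -
  let ?V = "octquad_verts n"
  define P where "P = {(u, v). u \<in> ?V \<and> v \<in> ?V \<and> u \<noteq> v}"
  define E where "E u v = F (gap (fst u) (fst v))" for u v :: "nat \<times> bool"
  have P: "P \<subseteq> ?V \<times> ?V" by (auto simp: P_def)
  have card_V: "card ?V = 8 * n"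
    by (simp add: octquad_verts_def card_cartesian_product)
  have "(\<Sum>(u, v)\<in>P. E u v) = (\<Sum>(u, v)\<in>?V \<times> ?V. E u v)"
    by (rule sum.mono_neutral_left) (use P in \<open>auto simp: P_def E_def gap_def F(1)\<close>)
  also have "\<dots> = (\<Sum>u\<in>?V. \<Sum>v\<in>?V. E u v)"
    by (simp add: sum.cartesian_product)
  also have "\<dots> = (\<Sum>u\<in>?V. 2 * (\<Sum>d<4 * n. F d))"
  proof (rule sum.cong[OF refl])
    fix u assume "u \<in> ?V"
    then have u: "1 \<le> fst u" "fst u \<le> 4 * n" by (cases u; simp)+
    have "(\<Sum>v\<in>?V. E u v) = (\<Sum>j = 1..4 * n. \<Sum>b\<in>(UNIV :: bool set). F (gap (fst u) j))"
      by (simp only: octquad_verts_def E_def sum.cartesian_product case_prod_unfold)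
    also have "\<dots> = 2 * (\<Sum>j = 1..4 * n. F (gap (fst u) j))"
      by (simp add: sum_distrib_left)
    finally show "(\<Sum>v\<in>?V. E u v) = 2 * (\<Sum>d<4 * n. F d)"
      using sum_gap[of "4 * n" F "fst u"] F(2) u by simp
  qed
  also have "\<dots> = 16 * real n * (\<Sum>d<4 * n. F d)"
    by (simp add: card_V)
  finally have main: "(\<Sum>(u, v)\<in>P. E u v) = 16 * real n * (\<Sum>d<4 * n. F d)" .
  have "\<bar>(\<Sum>(u, v)\<in>P. D u v) - (\<Sum>(u, v)\<in>P. E u v)\<bar> \<le> (\<Sum>(u, v)\<in>P. \<bar>D u v - E u v\<bar>)"
    by (simp add: sum_subtractf[symmetric] case_prod_unfold sum_abs)
  also have "\<dots> \<le> (\<Sum>(u, v)\<in>?V \<times> ?V. \<bar>D u v - E u v\<bar>)"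
    by (rule sum_mono2) (use P in auto)
  also have "\<dots> \<le> (\<Sum>(u, v)\<in>?V \<times> ?V. C)"
    by (rule sum_mono) (use approx in \<open>auto simp: E_def\<close>)
  also have "\<dots> = 64 * C * (real n)\<^sup>2"
    by (simp add: case_prod_unfold card_cartesian_product card_V power2_eq_square)
  finally show ?thesis
    unfolding main by (simp add: pair_sum_def V P_def[symmetric])
qed

lemma sum_min_reflect: "(\<Sum>d<2 * m. real (min d (2 * m - d))) = (real m)\<^sup>2"
proof -
  have split: "{..<2 * m} = {..<m} \<union> {m..<2 * m}" by auto
  have "(\<Sum>d<2 * m. real (min d (2 * m - d))) =
      (\<Sum>d<m. real (min d (2 * m - d))) + (\<Sum>d = m..<2 * m. real (min d (2 * m - d)))"
    unfolding split by (rule sum.union_disjoint) auto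
  also have "(\<Sum>d<m. real (min d (2 * m - d))) = (\<Sum>d<m. real d)"
    by (rule sum.cong) auto
  also have "(\<Sum>d = m..<2 * m. real (min d (2 * m - d))) = (\<Sum>d<m. real (d + 1))"
    by (rule sum.reindex_bij_witness[of _ "\<lambda>d. 2 * m - 1 - d" "\<lambda>d. 2 * m - 1 - d"]) auto
  also have "(\<Sum>d<m. real d) + (\<Sum>d<m. real (d + 1)) = (real m)\<^sup>2"
    by (induction m) (auto simp: power2_eq_square algebra_simps)
  finally show ?thesis .
qed

lemma sum_cycle_resistance:
  assumes "L > 0"
  shows "(\<Sum>d<L. cycle_resistance L d) = ((real L)\<^sup>2 - 1) / 12"
proof -
  have "(\<Sum>d<N. real d * (real L - real d)) =
      real N * (real N - 1) * (3 * real L - 2 * real N + 1) / 6" for N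
    by (induction N) (auto simp: field_simps)
  from this[of L] show ?thesis
    using assms by (simp add: cycle_resistance_def sum_divide_distrib[symmetric] power2_eq_square field_simps)
qed

section \<open>The two indices and their ratio\<close>

lemma wiener_index_octquad_ring_approx:
  assumes "n \<ge> 1"
  shows "\<bar>wiener_index (octquad_ring \<tau> n) - 32 * real n ^ 3\<bar> \<le> 96 * (real n)\<^sup>2"
proof -
  define F where "F d = real (min d (4 * n - d))" for d
  have "(\<Sum>d<4 * n. F d) = 4 * (real n)\<^sup>2"
    using sum_min_reflect[of "2 * n"] by (simp add: F_def power2_eq_square)
  moreover have "\<bar>wiener_index (octquad_ring \<tau> n) - 8 * real n * (\<Sum>d<4 * n. F d)\<bar> \<le> 32 * 3 * (real n)\<^sup>2"
    unfolding wiener_index_def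
    by (rule pair_sum_approx)
       (use octquad_ring_graph_dist_approx[OF assms, of _ _ \<tau>] in \<open>auto simp: F_def min.commute\<close>)
  ultimately show ?thesis by (simp add: power2_eq_square power3_eq_cube)
qed

lemma kirchhoff_index_octquad_ring_approx:
  assumes "n \<ge> 1"
  shows "\<bar>kirchhoff_index (octquad_ring \<tau> n) - (32 * real n ^ 3 - 2 * real n) / 3\<bar> \<le> 128 * (real n)\<^sup>2"
proof -
  define F where "F = cycle_resistance (4 * n)"
  have sum_F: "(\<Sum>d<4 * n. F d) = (16 * (real n)\<^sup>2 - 1) / 12"
    using sum_cycle_resistance[of "4 * n"] assms by (simp add: F_def power2_eq_square)
  have "\<bar>kirchhoff_index (octquad_ring \<tau> n) - 8 * real n * (\<Sum>d<4 * n. F d)\<bar> \<le> 32 * 4 * (real n)\<^sup>2"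
    unfolding kirchhoff_index_def
  proof (rule pair_sum_approx)
    show "F (4 * n - d) = F d" if "d \<le> 4 * n" for d
      using that by (simp add: F_def cycle_resistance_def of_nat_diff)
  qed (use octquad_ring_resistance_approx[OF assms, of _ _ \<tau>] in \<open>auto simp: F_def cycle_resistance_def\<close>)
  moreover have "8 * real n * ((16 * (real n)\<^sup>2 - 1) / 12) = (32 * real n ^ 3 - 2 * real n) / 3"
    by (simp add: power2_eq_square power3_eq_cube field_simps)
  ultimately show ?thesis unfolding sum_F by simp
qed

lemma tendsto_cubic_coefficient:
  fixes X :: "nat \<Rightarrow> real"
  assumes "\<And>n. n \<ge> 1 \<Longrightarrow> \<bar>X n - a * real n ^ 3\<bar> \<le> C * (real n)\<^sup>2"
  shows "(\<lambda>n. X n / real n ^ 3) \<longlonglongrightarrow> a"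
proof -
  have "\<bar>X n / real n ^ 3 - a\<bar> \<le> C / real n" if "n \<ge> 1" for n
  proof -
    have "X n / real n ^ 3 - a = (X n - a * real n ^ 3) / real n ^ 3"
      using that by (simp add: diff_divide_distrib)
    then have "\<bar>X n / real n ^ 3 - a\<bar> = \<bar>X n - a * real n ^ 3\<bar> / real n ^ 3"
      by simp
    also have "\<dots> \<le> C * (real n)\<^sup>2 / real n ^ 3"
      using assms[OF that] by (intro divide_right_mono) auto
    also have "\<dots> = C / real n"
      using that by (simp add: power2_eq_square power3_eq_cube)
    finally show ?thesis .
  qed
  then have "(\<lambda>n. X n / real n ^ 3 - a) \<longlonglongrightarrow> 0"
    by (intro Lim_null_comparison[OF _ lim_const_over_n[of C]])
       (auto simp: eventually_sequentially intro!: exI[of _ 1])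
  then show ?thesis by (simp add: LIM_zero_iff)
qed

lemma octquad_ring_wiener_kirchhoff_ratio:
  "(\<lambda>n. wiener_index (octquad_ring \<tau> n) / kirchhoff_index (octquad_ring \<tau> n)) \<longlonglongrightarrow> 3"
proof -
  have W: "(\<lambda>n. wiener_index (octquad_ring \<tau> n) / real n ^ 3) \<longlonglongrightarrow> 32"
    by (rule tendsto_cubic_coefficient[OF wiener_index_octquad_ring_approx])
  have K: "(\<lambda>n. kirchhoff_index (octquad_ring \<tau> n) / real n ^ 3) \<longlonglongrightarrow> 32 / 3"
  proof (rule tendsto_cubic_coefficient)
    fix n :: nat assume n: "n \<ge> 1"
    then have "real n \<le> (real n)\<^sup>2" by (simp add: power2_eq_square)
    then show "\<bar>kirchhoff_index (octquad_ring \<tau> n) - 32 / 3 * real n ^ 3\<bar> \<le> 129 * (real n)\<^sup>2"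
      using kirchhoff_index_octquad_ring_approx[OF n, of \<tau>] by (simp add: abs_le_iff diff_divide_distrib; linarith)
  qed
  have "(\<lambda>n. (wiener_index (octquad_ring \<tau> n) / real n ^ 3) / (kirchhoff_index (octquad_ring \<tau> n) / real n ^ 3))
      \<longlonglongrightarrow> 32 / (32 / 3)"
    by (rule tendsto_divide[OF W K]) simp
  moreover have "\<forall>\<^sub>F n in sequentially.
      (wiener_index (octquad_ring \<tau> n) / real n ^ 3) / (kirchhoff_index (octquad_ring \<tau> n) / real n ^ 3)
      = wiener_index (octquad_ring \<tau> n) / kirchhoff_index (octquad_ring \<tau> n)"
    by (rule eventually_sequentiallyI[of 1]) simp
  ultimately have "(\<lambda>n. wiener_index (octquad_ring \<tau> n) / kirchhoff_index (octquad_ring \<tau> n))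
      \<longlonglongrightarrow> 32 / (32 / 3)"
    by (rule Lim_transform_eventually)
  then show ?thesis by simp
qed

theorem corollary4p3:
  shows "((\<lambda>n. wiener_index (octquad_moebius n) / kirchhoff_index (octquad_moebius n)) \<longlonglongrightarrow> 3) \<and>
         ((\<lambda>n. wiener_index (octquad_cylinder n) / kirchhoff_index (octquad_cylinder n)) \<longlonglongrightarrow> 3)"
  unfolding octquad_moebius_eq_ring octquad_cylinder_eq_ring
  by (intro conjI octquad_ring_wiener_kirchhoff_ratio)

end
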